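(* Let $q$ be a prime power, let $0\le r\le n$ be integers with $n\ge 1$, and let $s=|\mathbb{F}_q^{+}|$ be the number of positive elements of $\mathbb{F}_q$. Let $\mathrm{psd}_4(n,r)$ be the number of positive semidefinite matrices of type 4 in $M_n(\mathbb{F}_q)$ having rank $r$. Then $$\mathrm{psd}_4(n,r)=\sum_{\substack{k_1+\cdots+k_s=r\\ k_i\ge 0}}\frac{|\mathrm{O}_n(\mathbb{F}_q)|}{|\mathrm{O}_{k_1}(\mathbb{F}_q)|\,|\mathrm{O}_{k_2}(\mathbb{F}_q)|\cdots|\mathrm{O}_{k_s}(\mathbb{F}_q)|\,|\mathrm{O}_{n-r}(\mathbb{F}_q)|},$$ where the sum is over all $s$-tuples $(k_1,\dots,k_s)$ of nonnegative integers with sum $r$.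
   Context: An element $a\in\mathbb{F}_q^\times$ is positive if $a=b^2$ for some $b\in\mathbb{F}_q^\times$; $\mathbb{F}_q^{+}$ is the set of positive elements; an element is nonnegative if it is positive or zero. $\mathrm{O}_k(\mathbb{F}_q)=\{U\in\mathrm{GL}_k(\mathbb{F}_q):U^TU=I_k\}$, with the convention $|\mathrm{O}_0(\mathbb{F}_q)|=1$. A symmetric matrix $A\in M_n(\mathbb{F}_q)$ is positive semidefinite of type 4 if $A=U^{-1}DU$ for some $U\in\mathrm{O}_n(\mathbb{F}_q)$ and some diagonal matrix $D\in M_n(\mathbb{F}_q)$ with all diagonal entries nonnegative. *)

theory Defs
  imports "Jordan_Normal_Form.DL_Rank"
begin

text \<open>The finite field is a type \<^typ>\<open>'a\<close> of class \<^class>\<open>field\<close> and \<^class>\<open>finite\<close>, so its order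
  \<open>CARD('a)\<close> plays the role of the prime power \<open>q\<close>.  Sizes of matrices vary inside the
  statement, so matrices are the dimension-carrying ones of \<^theory>\<open>Jordan_Normal_Form.Matrix\<close>.\<close>

definition positive :: "'a::field \<Rightarrow> bool" where
  "positive a \<longleftrightarrow> a \<noteq> 0 \<and> (\<exists>b. b \<noteq> 0 \<and> a = b\<^sup>2)"

definition nonnegative :: "'a::field \<Rightarrow> bool" where
  "nonnegative a \<longleftrightarrow> positive a \<or> a = 0"

text \<open>The predicate \<^const>\<open>orthogonal_mat\<close> of the library only asks \<open>U\<^sup>T U\<close> to be diagonal with
  nonzero diagonal entries, hence this separate definition.\<close>

definition orthogonal_group :: "nat \<Rightarrow> 'a::field mat set" where
  "orthogonal_group k =
     {U \<in> carrier_mat k k. invertible_mat U \<and> transpose_mat U * U = 1\<^sub>m k}"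

lemma card_orthogonal_group_0: "card (orthogonal_group 0 :: 'a::field mat set) = 1"
proof -
  have inv: "invertible_mat (1\<^sub>m 0 :: 'a mat)"
    unfolding invertible_mat_def inverts_mat_def by (auto intro!: exI[of _ "1\<^sub>m 0"])
  have "U = 1\<^sub>m 0" if "U \<in> carrier_mat 0 0" for U :: "'a mat"
    using that by (intro eq_matI) auto
  then have "(orthogonal_group 0 :: 'a mat set) = {1\<^sub>m 0}"
    using inv unfolding orthogonal_group_def by auto
  then show ?thesis by simp
qed

text \<open>In \<open>similar_mat_wit A D V U\<close> the matrix \<open>V\<close> is the two-sided inverse of \<open>U\<close>, and
  \<open>A = V * D * U\<close>.\<close>

definition psd_type4 :: "nat \<Rightarrow> 'a::field mat \<Rightarrow> bool" where
  "psd_type4 n A \<longleftrightarrow>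
     A \<in> carrier_mat n n \<and> transpose_mat A = A \<and>
     (\<exists>U \<in> orthogonal_group n. \<exists>V D.
        diagonal_mat D \<and> (\<forall>i<n. nonnegative (D $$ (i, i))) \<and> similar_mat_wit A D V U)"

definition psd4_set :: "nat \<Rightarrow> nat \<Rightarrow> 'a::field mat set" where
  "psd4_set n r = {A. psd_type4 n A \<and> vec_space.rank n A = r}"

end

theory Submission
  imports Defs "Jordan_Normal_Form.Char_Poly"
begin

text \<open>The orthogonal group acts by conjugation, and the matrices in question form the union of the
  orbits of the diagonal matrices with nonnegative entries.  Such an orbit is determined by the
  multiset of diagonal entries: permutation matrices are orthogonal, and the characteristic
  polynomial recovers the multiset.  The stabilizer of a diagonal matrix consists of the orthogonal
  matrices that are block diagonal with respect to the eigenspaces, so it is a product of smaller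
  orthogonal groups, one for each eigenvalue, of the size of its multiplicity.  The orbit-stabilizer
  formula gives the summand, where \<open>k\<^sub>i\<close> is the multiplicity of the \<open>i\<close>-th positive element and
  rank \<open>r\<close> means that \<open>0\<close> has multiplicity \<open>n - r\<close>.\<close>

section \<open>Matrices over a finite field and the orthogonal group\<close>

lemma transpose_mat_diag [simp]: "transpose_mat (mat_diag n f) = mat_diag n f"
  by (rule eq_matI) (auto simp: mat_diag_def)

lemma finite_carrier_mat: "finite (carrier_mat m n :: 'a::finite mat set)"
proof (rule finite_subset)
  let ?I = "{..<m} \<times> {..<n}"
  show "carrier_mat m n \<subseteq> Matrix.mat m n ` (PiE ?I (\<lambda>_. UNIV :: 'a set))"
  proof
    fix A :: "'a mat" assume A: "A \<in> carrier_mat m n"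
    have "A = Matrix.mat m n (restrict (($$) A) ?I)"
      using A by (intro eq_matI) auto
    then show "A \<in> Matrix.mat m n ` (PiE ?I (\<lambda>_. UNIV :: 'a set))"
      by (rule image_eqI[where x = "restrict (($$) A) ?I"]) simp
  qed
qed (auto intro!: finite_imageI finite_PiE)

lemma finite_orthogonal_group: "finite (orthogonal_group n :: 'a::{field,finite} mat set)"
  by (rule finite_subset[OF _ finite_carrier_mat[of n n]]) (auto simp: orthogonal_group_def)

text \<open>A one-sided inverse of a square matrix over a field is two-sided, so the transpose
  witnesses invertibility.\<close>

lemma orthogonal_groupI:
  assumes "U \<in> carrier_mat n n" "transpose_mat U * U = 1\<^sub>m n"
  shows "U \<in> orthogonal_group n"
proof -
  have "U * transpose_mat U = 1\<^sub>m n"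
    by (rule mat_mult_left_right_inverse[OF _ _ assms(2)]) (use assms(1) in simp_all)
  then have "inverts_mat U (transpose_mat U)" "inverts_mat (transpose_mat U) U"
    using assms by (simp_all add: inverts_mat_def)
  then show ?thesis
    using assms by (auto simp: orthogonal_group_def invertible_mat_def)
qed

lemma orthogonal_groupD:
  assumes "U \<in> orthogonal_group n"
  shows "transpose_mat U * U = 1\<^sub>m n" "U * transpose_mat U = 1\<^sub>m n"
proof -
  show 1: "transpose_mat U * U = 1\<^sub>m n" using assms by (simp add: orthogonal_group_def)
  show "U * transpose_mat U = 1\<^sub>m n"
    by (rule mat_mult_left_right_inverse[OF _ _ 1]) (use assms in \<open>simp_all add: orthogonal_group_def\<close>)
qed

lemma orthogonal_group_carrier [simp]: "U \<in> orthogonal_group n \<Longrightarrow> U \<in> carrier_mat n n"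
  by (simp add: orthogonal_group_def)

lemma one_in_orthogonal_group [simp]: "1\<^sub>m n \<in> orthogonal_group n"
  by (rule orthogonal_groupI) auto

lemma transpose_in_orthogonal_group:
  "U \<in> orthogonal_group n \<Longrightarrow> transpose_mat U \<in> orthogonal_group n"
  by (rule orthogonal_groupI) (auto simp: orthogonal_groupD)

lemma mult_in_orthogonal_group:
  assumes U: "U \<in> orthogonal_group n" and V: "V \<in> orthogonal_group n"
  shows "U * V \<in> orthogonal_group n"
proof (rule orthogonal_groupI)
  note [simp] = orthogonal_group_carrier[OF U] orthogonal_group_carrier[OF V]
  show "U * V \<in> carrier_mat n n" by (rule mult_carrier_mat[of _ n n]) simp_all
  have "transpose_mat (U * V) * (U * V) = transpose_mat V * (transpose_mat U * U) * V"
    by (simp add: transpose_mult[of _ n n _ n] assoc_mult_mat[of _ n n _ n _ n] mult_carrier_mat[of _ n n _ n])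
  then show "transpose_mat (U * V) * (U * V) = 1\<^sub>m n"
    using U V by (simp add: orthogonal_groupD right_mult_one_mat[of _ n n])
qed

text \<open>Orthonormality of the columns, spelled out in entries. In this form it can be checked
  for permutation matrices and carried over to submatrices by restricting and reindexing the
  sum.\<close>

lemma orthogonal_group_iff_sum:
  "U \<in> orthogonal_group n \<longleftrightarrow> U \<in> carrier_mat n n \<and>
    (\<forall>j<n. \<forall>k<n. (\<Sum>i<n. U $$ (i, j) * U $$ (i, k)) = (if j = k then 1 else 0))"
    (is "_ \<longleftrightarrow> ?R")
proof
  assume U: "U \<in> orthogonal_group n"
  note c = orthogonal_group_carrier[OF U]
  show ?R
  proof (intro conjI allI impI c)
    fix j k assume jk: "j < n" "k < n"
    have "(transpose_mat U * U) $$ (j, k) = (1\<^sub>m n :: 'a mat) $$ (j, k)"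
      using orthogonal_groupD[OF U] by simp
    then show "(\<Sum>i<n. U $$ (i, j) * U $$ (i, k)) = (if j = k then 1 else 0)"
      using jk c by (simp add: scalar_prod_def lessThan_atLeast0)
  qed
next
  assume R: ?R
  then have c: "U \<in> carrier_mat n n" by blast
  show "U \<in> orthogonal_group n"
  proof (rule orthogonal_groupI[OF c], rule eq_matI)
    fix j k assume "j < dim_row (1\<^sub>m n :: 'a mat)" "k < dim_col (1\<^sub>m n :: 'a mat)"
    then show "(transpose_mat U * U) $$ (j, k) = (1\<^sub>m n :: 'a mat) $$ (j, k)"
      using R c by (simp add: scalar_prod_def lessThan_atLeast0)
  qed (use c in auto)
qed

subsection \<open>Orthogonal orbits of diagonal matrices\<close>

definition diag_orbit :: "nat \<Rightarrow> (nat \<Rightarrow> 'a::field) \<Rightarrow> 'a mat set" where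
  "diag_orbit n f = (\<lambda>U. transpose_mat U * mat_diag n f * U) ` orthogonal_group n"

lemma diag_orbit_carrier:
  assumes "A \<in> diag_orbit n f"
  shows "A \<in> carrier_mat n n"
  using assms unfolding diag_orbit_def by (auto intro!: mult_carrier_mat[of _ n n])

text \<open>The inverse \<open>V\<close> of an orthogonal \<open>U\<close> is forced to be its
  transpose, since V = V(U U^T) = (V U)U^T. Conversely, U^T D U inherits symmetry from the diagonal
  matrix D.\<close>

lemma psd_type4_iff:
  "psd_type4 n A \<longleftrightarrow> (\<exists>f. (\<forall>i<n. nonnegative (f i)) \<and> A \<in> diag_orbit n f)"
proof
  assume "psd_type4 n A"
  then obtain U V D where A: "A \<in> carrier_mat n n" and U: "U \<in> orthogonal_group n"
    and D: "diagonal_mat D" "\<forall>i<n. nonnegative (D $$ (i, i))" and s: "similar_mat_wit A D V U"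
    by (auto simp: psd_type4_def)
  note w = similar_mat_witD2[OF A s]
  have "V = V * (U * transpose_mat U)"
    unfolding orthogonal_groupD[OF U] using w by simp
  also have "\<dots> = V * U * transpose_mat U"
    using w(6,7) by (simp add: assoc_mult_mat[of _ n n _ n _ n])
  also have "\<dots> = transpose_mat U" unfolding w(1) using w by simp
  finally have V: "V = transpose_mat U" .
  define f where "f = (\<lambda>i. D $$ (i, i))"
  have "D = mat_diag n f"
    using D(1) w(5) by (intro eq_matI) (auto simp: f_def mat_diag_def diagonal_mat_def)
  then have "A = transpose_mat U * mat_diag n f * U" using w(3) V by simp
  then have "A \<in> diag_orbit n f" unfolding diag_orbit_def by (rule image_eqI) (rule U)
  then show "\<exists>f. (\<forall>i<n. nonnegative (f i)) \<and> A \<in> diag_orbit n f"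
    using D(2) by (auto simp: f_def)
next
  assume "\<exists>f. (\<forall>i<n. nonnegative (f i)) \<and> A \<in> diag_orbit n f"
  then obtain f U where f: "\<forall>i<n. nonnegative (f i)" and U: "U \<in> orthogonal_group n"
    and A: "A = transpose_mat U * mat_diag n f * U"
    by (auto simp: diag_orbit_def)
  note c = orthogonal_group_carrier[OF U]
  have Ac: "A \<in> carrier_mat n n"
    unfolding A using c by (auto intro!: mult_carrier_mat[of _ n n])
  have "similar_mat_wit A (mat_diag n f) (transpose_mat U) U"
    by (rule similar_mat_witI[of _ _ n]) (use Ac A c orthogonal_groupD[OF U] in auto)
  moreover have "transpose_mat A = A"
    unfolding A using c
    by (simp add: transpose_mult[of _ n n _ n] assoc_mult_mat[of _ n n _ n _ n] mult_carrier_mat[of _ n n _ n])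
  moreover have "diagonal_mat (mat_diag n f)"
    by (auto simp: diagonal_mat_def mat_diag_def)
  moreover have "\<forall>i<n. nonnegative (mat_diag n f $$ (i, i))"
    using f by (simp add: mat_diag_def)
  ultimately show "psd_type4 n A" using U Ac unfolding psd_type4_def by blast
qed

section \<open>Invariants of an orbit: spectrum and rank\<close>

lemma diag_orbit_similar:
  assumes "A \<in> diag_orbit n f"
  obtains U where "U \<in> orthogonal_group n" "similar_mat_wit A (mat_diag n f) (transpose_mat U) U"
proof -
  from assms obtain U where U: "U \<in> orthogonal_group n"
    and A: "A = transpose_mat U * mat_diag n f * U"
    by (auto simp: diag_orbit_def)
  have "similar_mat_wit A (mat_diag n f) (transpose_mat U) U"
    by (rule similar_mat_witI[of _ _ n])
      (use A orthogonal_group_carrier[OF U] orthogonal_groupD[OF U] in \<open>auto intro!: mult_carrier_mat[of _ n n]\<close>)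
  with U show ?thesis by (rule that)
qed

text \<open>Similar matrices share their characteristic polynomial, and that of a diagonal matrix
  splits into linear factors. The multiset of diagonal entries is therefore an invariant of the
  orbit.\<close>

lemma proots_char_poly_diag_orbit:
  assumes "A \<in> diag_orbit n f"
  shows "proots (char_poly A) = image_mset f (mset_set {..<n})"
proof -
  from assms obtain U where "similar_mat_wit A (mat_diag n f) (transpose_mat U) U"
    by (rule diag_orbit_similar)
  then have "char_poly A = char_poly (mat_diag n f)"
    by (intro char_poly_similar) (auto simp: similar_mat_def)
  also have "\<dots> = (\<Prod>a\<leftarrow>diag_mat (mat_diag n f). [:- a, 1:])"
    by (rule char_poly_upper_triangular[of _ n]) (auto simp: mat_diag_def)
  also have "diag_mat (mat_diag n f) = map f [0..<n]"
    by (auto simp: diag_mat_def mat_diag_def)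
  also have "(\<Prod>a\<leftarrow>map f [0..<n]. [:- a, 1:]) = (\<Prod>i\<in>{..<n}. [:- f i, 1:])"
    by (simp add: prod.distinct_set_conv_list[symmetric] lessThan_atLeast0 o_def)
  finally have "proots (char_poly A) = (\<Sum>i\<in>{..<n}. {#f i#})"
    by (simp add: proots_prod)
  also have "\<dots> = image_mset f (mset_set {..<n})"
    by (induction n) (simp_all add: lessThan_Suc)
  finally show ?thesis .
qed

text \<open>The columns of U^T are eigenvectors of \<open>A\<close>, with eigenvalues
  \<open>f i\<close>. Those with nonzero eigenvalue form a basis of the column space.\<close>

lemma rank_diag_orbit:
  assumes "A \<in> diag_orbit n (f :: nat \<Rightarrow> 'a::field)"
  shows "vec_space.rank n A = card {i. i < n \<and> f i \<noteq> 0}"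
proof -
  interpret vec_space "TYPE('a)" n .
  from assms obtain U where U: "U \<in> orthogonal_group n"
    and s: "similar_mat_wit A (mat_diag n f) (transpose_mat U) U"
    by (rule diag_orbit_similar)
  let ?V = "transpose_mat U"
  let ?S = "col ?V ` {i. i < n \<and> f i \<noteq> 0}"
  have c: "U \<in> carrier_mat n n" "?V \<in> carrier_mat n n" using U by auto
  have Ac: "A \<in> carrier_mat n n"
    using assms by (rule diag_orbit_carrier)
  have A: "A = ?V * mat_diag n f * U" using similar_mat_witD2(3)[OF Ac s] .
  have "det ?V * det U = 1"
    using orthogonal_groupD(1)[OF U] det_mult[OF c(2,1)] by simp
  then have "rank ?V = n" using det_rank_iff[OF c(2)] by auto
  \<comment> \<open>Distinctness matters twice: independence is stated for the set of columns, and
    the cardinality of that set must agree with the number of indices.\<close>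
  moreover from this have dist: "distinct (cols ?V)"
    using non_distinct_low_rank[OF c(2)] by auto
  ultimately have "lin_indpt (set (cols ?V))" using full_rank_lin_indpt[OF c(2)] by simp
  moreover have "?S \<subseteq> set (cols ?V)" using c by (auto simp: cols_def)
  ultimately have li: "lin_indpt ?S" by (meson subset_li_is_li)
  have Sc: "?S \<subseteq> carrier_vec n" using c by auto
  have colsA: "set (cols A) \<subseteq> carrier_vec n" using Ac cols_dim by blast
  have fact: "A *\<^sub>v x = ?V *\<^sub>v (mat_diag n f *\<^sub>v (U *\<^sub>v x))" if "x \<in> carrier_vec n" for x
    unfolding A using that c
    by (simp add: assoc_mult_mat_vec[of _ n n _ n] mult_carrier_mat[of _ n n _ n])
  have "?S \<subseteq> span (set (cols A))"
  proof
    fix v assume "v \<in> ?S"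
    then obtain i where i: "i < n" "f i \<noteq> 0" "v = col ?V i" by blast
    \<comment> \<open>This is the eigenvector \<open>col ?V i\<close> divided by its eigenvalue, so
      \<open>A\<close> maps it to \<open>col ?V i\<close>.\<close>
    let ?x = "?V *\<^sub>v ((1 / f i) \<cdot>\<^sub>v unit_vec n i)"
    have "U *\<^sub>v ?x = (U * ?V) *\<^sub>v ((1 / f i) \<cdot>\<^sub>v unit_vec n i)"
      using c by (simp add: assoc_mult_mat_vec[of _ n n _ n])
    also have "\<dots> = (1 / f i) \<cdot>\<^sub>v unit_vec n i" using orthogonal_groupD(2)[OF U] by simp
    also have "mat_diag n f *\<^sub>v \<dots> = unit_vec n i"
      using i by (intro eq_vecI) (auto simp: mat_diag_def scalar_prod_def unit_vec_def if_distrib cong: if_cong)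
    finally have "A *\<^sub>v ?x = ?V *\<^sub>v unit_vec n i" using c by (simp add: fact)
    also have "\<dots> = v" using i c by (intro eq_vecI) (auto simp: scalar_prod_right_unit)
    finally have "v \<in> col_space A"
      using c Ac i by (auto simp: col_space_eq[OF Ac] intro!: bexI[of _ ?x])
    then show "v \<in> span (set (cols A))" by (simp add: col_space_def)
  qed
  then have 1: "span ?S \<subseteq> span (set (cols A))"
    by (rule span_subsetI[OF colsA])
  \<comment> \<open>Since A = B U, the column space of \<open>A\<close> lies in that of
    \<open>?B\<close>, whose columns are the multiples \<open>f i\<close> of the columns of U^T;
    those with \<open>f i = 0\<close> vanish.\<close>
  let ?B = "?V * mat_diag n f"
  have "set (cols A) \<subseteq> span ?S"
  proof
    fix v assume v: "v \<in> set (cols A)"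
    then have "v \<in> col_space A" 
      unfolding col_space_def using colsA by (intro span_mem) auto
    then obtain x where x: "x \<in> carrier_vec n" "v = A *\<^sub>v x"
      using Ac by (auto simp: col_space_eq[OF Ac])
    have "v = ?B *\<^sub>v (U *\<^sub>v x)"
      using x c A by (simp add: assoc_mult_mat_vec[of _ n n _ n] mult_carrier_mat[of _ n n _ n])
    moreover have Bc: "?B \<in> carrier_mat n n" using c by (simp add: mult_carrier_mat[of _ n n _ n])
    ultimately have "v \<in> col_space ?B"
      unfolding col_space_eq[OF Bc] carrier_matD[OF Bc] using c(1) x(1)
      by (intro CollectI conjI bexI[of _ "U *\<^sub>v x"])
        (simp_all only: mult_mat_vec_carrier[OF Bc] mult_mat_vec_carrier[of U n n])
    moreover have "set (cols ?B) \<subseteq> span ?S"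
    proof
      fix w assume "w \<in> set (cols ?B)"
      then obtain i where i: "i < n" "w = col ?B i" using Bc by (auto simp: cols_def)
      have w: "w = f i \<cdot>\<^sub>v col ?V i"
        unfolding i mat_diag_mult_right[OF c(2)] using i c
        by (intro eq_vecI) auto
      have ci: "col ?V i \<in> carrier_vec n" using c i by auto
      show "w \<in> span ?S"
      proof (cases "f i = 0")
        case True
        then have "w = 0\<^sub>v n" using w ci by auto
        moreover have "0\<^sub>v n \<in> span ?S"
          using span_is_monotone[of "{}" ?S] span_empty by auto
        ultimately show ?thesis by simp
      next
        case False
        then have "col ?V i \<in> span ?S" using i Sc by (intro span_mem) auto
        then show ?thesis using w Sc by (simp add: smult_in_span)
      qed
    qed
    ultimately show "v \<in> span ?S" unfolding col_space_def
      using span_subsetI[OF Sc] by blast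
  qed
  then have 2: "span (set (cols A)) \<subseteq> span ?S"
    by (rule span_subsetI[OF Sc])
  have "rank A = vectorspace.dim class_ring (span_vs ?S)"
    using 1 2 by (simp add: rank_def)
  also have "\<dots> = card ?S"
    using Sc li by (intro dim_span) (auto simp: maximal_def)
  also have "\<dots> = card {i. i < n \<and> f i \<noteq> 0}"
  proof (rule card_image, rule inj_onI)
    fix i j assume "i \<in> {i. i < n \<and> f i \<noteq> 0}" "j \<in> {i. i < n \<and> f i \<noteq> 0}" "col ?V i = col ?V j"
    then show "i = j" using dist c by (auto simp: distinct_conv_nth)
  qed
  finally show ?thesis .
qed

text \<open>Equal multisets differ by a permutation of the indices, and its permutation matrix P is
  orthogonal. It conjugates one diagonal matrix into the other, so \<open>U\<close> can be replaced
  by \<open>P * U\<close>.\<close>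

lemma diag_orbit_subset_if_mset_eq:
  assumes "image_mset f (mset_set {..<n}) = image_mset g (mset_set {..<n})"
  shows "diag_orbit n f \<subseteq> diag_orbit n (g :: nat \<Rightarrow> 'a::field)"
proof -
  obtain p where p: "p permutes {..<n}" and fg: "\<forall>i\<in>{..<n}. f i = g (p i)"
    using image_mset_eq_implies_permutes[OF finite_lessThan assms] .
  have pn: "p i < n" if "i < n" for i using permutes_in_image[OF p, of i] that by simp
  have pinj: "p i = p j \<longleftrightarrow> i = j" for i j using permutes_inj[OF p] by (auto dest: injD)
  define P :: "'a mat" where "P = Matrix.mat n n (\<lambda>(i, j). if i = p j then 1 else 0)"
  have Pc: "P \<in> carrier_mat n n" by (simp add: P_def)
  \<comment> \<open>This is the entry (j, k) of P^T diag(h) P. Taking h = 1 shows that P is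
    orthogonal, and h = g gives the conjugation of the diagonal matrices.\<close>
  have sum1: "(\<Sum>i<n. (if i = p j then 1 else 0) * (h i * (if i = p k then 1 else 0))) =
      (if j = k then h (p k) else 0)" if "j < n" "k < n" for j k and h :: "nat \<Rightarrow> 'a"
  proof -
    have "(\<Sum>i<n. (if i = p j then 1 else 0) * (h i * (if i = p k then 1 else 0))) =
        (\<Sum>i<n. if i = p k then (if j = k then h i else 0) else 0)"
      by (rule sum.cong) (auto simp: pinj)
    also have "\<dots> = (if j = k then h (p k) else 0)" using pn that by (simp add: sum.delta)
    finally show ?thesis .
  qed
  have P: "P \<in> orthogonal_group n"
    unfolding orthogonal_group_iff_sum
  proof (intro conjI allI impI Pc)
    fix j k assume "j < n" "k < n"
    then show "(\<Sum>i<n. P $$ (i, j) * P $$ (i, k)) = (if j = k then 1 else 0)"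
      using sum1[of j k "\<lambda>_. 1"] by (simp add: P_def)
  qed
  have D: "mat_diag n f = transpose_mat P * (mat_diag n g * P)"
  proof (rule eq_matI)
    fix j k assume "j < dim_row (transpose_mat P * (mat_diag n g * P))"
      "k < dim_col (transpose_mat P * (mat_diag n g * P))"
    then have jk: "j < n" "k < n" using Pc by simp_all
    then show "mat_diag n f $$ (j, k) = (transpose_mat P * (mat_diag n g * P)) $$ (j, k)"
      using sum1[OF jk, of g] fg
      unfolding mat_diag_mult_left[OF Pc]
      by (simp add: P_def mat_diag_def scalar_prod_def lessThan_atLeast0)
  qed (use Pc in \<open>simp_all add: mat_diag_def\<close>)
  show ?thesis
  proof
    fix A assume "A \<in> diag_orbit n f"
    then obtain U where U: "U \<in> orthogonal_group n" and A: "A = transpose_mat U * mat_diag n f * U"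
      by (auto simp: diag_orbit_def)
    have "A = transpose_mat (P * U) * mat_diag n g * (P * U)"
      unfolding A D using orthogonal_group_carrier[OF U] Pc
      by (simp add: transpose_mult[of _ n n _ n] assoc_mult_mat[of _ n n _ n _ n] mult_carrier_mat[of _ n n _ n])
    then show "A \<in> diag_orbit n g"
      unfolding diag_orbit_def by (rule image_eqI) (rule mult_in_orthogonal_group[OF P U])
  qed
qed

lemma diag_orbit_cong:
  assumes "image_mset f (mset_set {..<n}) = image_mset g (mset_set {..<n})"
  shows "diag_orbit n f = diag_orbit n g"
  using diag_orbit_subset_if_mset_eq[OF assms] diag_orbit_subset_if_mset_eq[OF assms[symmetric]]
  by (rule equalityI)

subsection \<open>Stabilizers\<close>

definition diag_stabilizer :: "nat \<Rightarrow> (nat \<Rightarrow> 'a::field) \<Rightarrow> 'a mat set" where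
  "diag_stabilizer n f =
    {U \<in> orthogonal_group n. transpose_mat U * mat_diag n f * U = mat_diag n f}"

text \<open>For orthogonal U, fixing D means commuting with it. Comparing the entries of D U and U D
  gives (f i - f j) U_ij = 0.\<close>

lemma diag_stabilizer_iff:
  "U \<in> diag_stabilizer n f \<longleftrightarrow>
    U \<in> orthogonal_group n \<and> (\<forall>i<n. \<forall>j<n. f i \<noteq> f j \<longrightarrow> U $$ (i, j) = 0)"
proof (cases "U \<in> orthogonal_group n")
  case True
  let ?D = "mat_diag n f"
  note c = orthogonal_group_carrier[OF True]
  have "transpose_mat U * ?D * U = ?D \<longleftrightarrow> ?D * U = U * ?D"
  proof
    assume "transpose_mat U * ?D * U = ?D"
    then have "U * ?D = U * (transpose_mat U * ?D * U)" by (rule arg_cong[OF sym])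
    also have "\<dots> = U * transpose_mat U * (?D * U)"
      using c by (simp add: assoc_mult_mat[of _ n n _ n _ n] mult_carrier_mat[of _ n n _ n])
    also have "\<dots> = ?D * U"
      unfolding orthogonal_groupD[OF True] using c
      by (intro left_mult_one_mat[of _ n n] mult_carrier_mat[of _ n n]) simp_all
    finally show "?D * U = U * ?D" by (rule sym)
  next
    assume eq: "?D * U = U * ?D"
    have "transpose_mat U * ?D * U = transpose_mat U * (?D * U)"
      using c by (simp add: assoc_mult_mat[of _ n n _ n _ n] mult_carrier_mat[of _ n n _ n])
    also have "\<dots> = transpose_mat U * U * ?D"
      unfolding eq using c by (simp add: assoc_mult_mat[of _ n n _ n _ n] mult_carrier_mat[of _ n n _ n])
    also have "\<dots> = ?D"
      unfolding orthogonal_groupD[OF True] by (rule left_mult_one_mat[of _ n n]) simp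
    finally show "transpose_mat U * ?D * U = ?D" .
  qed
  also have "\<dots> \<longleftrightarrow> (\<forall>i<n. \<forall>j<n. f i * U $$ (i, j) = U $$ (i, j) * f j)"
    unfolding mat_diag_mult_left[OF c] mat_diag_mult_right[OF c]
    by (auto simp: mat_eq_iff)
  also have "\<dots> \<longleftrightarrow> (\<forall>i<n. \<forall>j<n. f i \<noteq> f j \<longrightarrow> U $$ (i, j) = 0)"
    by (auto simp: mult.commute)
  finally show ?thesis using True by (simp add: diag_stabilizer_def)
qed (simp add: diag_stabilizer_def)

text \<open>Orbit-stabilizer by counting fibres: the action is a right action, so the fibre of U ->
  U^T D U over V^T D V is the coset of the stabilizer translated on the right by V.\<close>

lemma card_diag_orbit_mult_card_diag_stabilizer:
  fixes f :: "nat \<Rightarrow> 'a::{field,finite}"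
  shows "card (diag_orbit n f) * card (diag_stabilizer n f) =
    card (orthogonal_group n :: 'a mat set)"
proof -
  let ?D = "mat_diag n f" and ?O = "orthogonal_group n :: 'a mat set"
  let ?c = "\<lambda>U. transpose_mat U * ?D * U"
  have fibre: "card {U \<in> ?O. ?c U = A} = card (diag_stabilizer n f)" if "A \<in> diag_orbit n f" for A
  proof -
    from that obtain V where V: "V \<in> ?O" and A: "A = ?c V" by (auto simp: diag_orbit_def)
    note Vc = orthogonal_group_carrier[OF V]
    have conj: "?c (W * X) = transpose_mat X * ?c W * X"
      if "W \<in> carrier_mat n n" "X \<in> carrier_mat n n" for W X :: "'a mat"
      using that by (simp add: transpose_mult[of _ n n _ n] assoc_mult_mat[of _ n n _ n _ n]
          mult_carrier_mat[of _ n n _ n])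
    have canc: "W * V * transpose_mat V = W" "W * transpose_mat V * V = W"
      if "W \<in> carrier_mat n n" for W
    proof -
      have "W * V * transpose_mat V = W * (V * transpose_mat V)" 
        "W * transpose_mat V * V = W * (transpose_mat V * V)"
        using that Vc by (simp_all add: assoc_mult_mat[of _ n n _ n _ n])
      then show "W * V * transpose_mat V = W" "W * transpose_mat V * V = W"
        unfolding orthogonal_groupD[OF V] using that by simp_all
    qed
    have cV: "transpose_mat (transpose_mat V) * ?c V * transpose_mat V = ?D"
    proof -
      have "?D = ?c (V * transpose_mat V)"
        unfolding orthogonal_groupD[OF V]
        by (simp add: left_mult_one_mat[of _ n n] right_mult_one_mat[of _ n n])
      also have "\<dots> = transpose_mat (transpose_mat V) * ?c V * transpose_mat V"
        by (rule conj) (use Vc in simp_all)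
      finally show ?thesis by (rule sym)
    qed
    \<comment> \<open>Right translation by \<open>V\<close> is undone by right translation by its
      transpose.\<close>
    have "bij_betw (\<lambda>W. W * V) (diag_stabilizer n f) {U \<in> ?O. ?c U = A}"
    proof (rule bij_betw_byWitness[where f' = "\<lambda>W. W * transpose_mat V"])
      show "\<forall>W\<in>diag_stabilizer n f. W * V * transpose_mat V = W"
        using canc by (auto simp: diag_stabilizer_def)
      show "\<forall>W\<in>{U \<in> ?O. ?c U = A}. W * transpose_mat V * V = W"
        using canc by auto
      show "(\<lambda>W. W * V) ` diag_stabilizer n f \<subseteq> {U \<in> ?O. ?c U = A}"
      proof (rule image_subsetI)
        fix W assume "W \<in> diag_stabilizer n f"
        then have W: "W \<in> ?O" "?c W = ?D" by (auto simp: diag_stabilizer_def)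
        have "?c (W * V) = A"
          unfolding conj[OF orthogonal_group_carrier[OF W(1)] Vc] W(2) A ..
        then show "W * V \<in> {U \<in> ?O. ?c U = A}"
          using mult_in_orthogonal_group[OF W(1) V] by simp
      qed
      show "(\<lambda>W. W * transpose_mat V) ` {U \<in> ?O. ?c U = A} \<subseteq> diag_stabilizer n f"
      proof (rule image_subsetI)
        fix W assume "W \<in> {U \<in> ?O. ?c U = A}"
        then have W: "W \<in> ?O" "?c W = A" by auto
        note Vt = transpose_in_orthogonal_group[OF V]
        have "?c (W * transpose_mat V) = ?D"
          unfolding conj[OF orthogonal_group_carrier[OF W(1)] orthogonal_group_carrier[OF Vt]] W(2) A
          by (rule cV)
        then show "W * transpose_mat V \<in> diag_stabilizer n f"
          using mult_in_orthogonal_group[OF W(1) Vt] unfolding diag_stabilizer_def by simp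
      qed
    qed
    then show ?thesis by (simp add: bij_betw_same_card)
  qed
  have "card ?O = (\<Sum>U\<in>?O. 1)" by simp
  \<comment> \<open>The fibres partition the group, and all of them have the size of the
    stabilizer.\<close>
  also have "\<dots> = (\<Sum>A\<in>?c ` ?O. \<Sum>U\<in>{U \<in> ?O. ?c U = A}. 1)"
    by (rule sum.image_gen[OF finite_orthogonal_group])
  also have "\<dots> = (\<Sum>A\<in>diag_orbit n f. card (diag_stabilizer n f))"
    unfolding diag_orbit_def[symmetric] by (rule sum.cong[OF refl]) (simp add: fibre)
  finally show ?thesis by simp
qed

text \<open>A matrix commuting with \<open>diag f\<close> only has nonzero entries inside the square blocks indexed by
  the fibres of \<open>f\<close>; \<open>e c\<close> below enumerates the fibre over \<open>c\<close> and \<open>g\<close> is the position of an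
  index inside its fibre.\<close>

lemma card_diag_stabilizer:
  fixes f :: "nat \<Rightarrow> 'a::{field,finite}"
  shows "card (diag_stabilizer n f) =
    (\<Prod>c\<in>UNIV. card (orthogonal_group (card {i. i < n \<and> f i = c}) :: 'a mat set))"
proof -
  define I where "I c = {i. i < n \<and> f i = c}" for c
  define k where "k c = card (I c)" for c
  have finI: "finite (I c)" for c by (simp add: I_def)
  then have "\<exists>h. bij_betw h {..<k c} (I c)" for c
    unfolding k_def by (metis ex_bij_betw_nat_finite lessThan_atLeast0)
  then obtain e where e: "\<And>c. bij_betw (e c) {..<k c} (I c)" by metis
  define g where "g i = inv_into {..<k (f i)} (e (f i)) i" for i
  have e_in: "e c a < n" "f (e c a) = c" if "a < k c" for c a
    using bij_betwE[OF e[of c]] that by (auto simp: I_def)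
  have e_inj: "e c a = e c b \<longleftrightarrow> a = b" if "a < k c" "b < k c" for c a b
    using bij_betw_imp_inj_on[OF e[of c]] that by (auto dest: inj_onD)
  have ge: "g (e c a) = a" if "a < k c" for c a
    using bij_betw_inv_into_left[OF e[of c], of a] e_in[OF that] that by (simp add: g_def)
  have eg: "e (f i) (g i) = i" if "i < n" for i
    using bij_betw_inv_into_right[OF e[of "f i"], of i] that by (simp add: g_def I_def)
  have g_lt: "g i < k (f i)" if "i < n" for i
    using bij_betw_inv_into[OF e[of "f i"]] that bij_betwE[of _ "I (f i)" "{..<k (f i)}"]
    by (auto simp: g_def I_def)
  \<comment> \<open>A sum supported on one fibre becomes a sum over positions in that fibre. This
    moves column products between a matrix and its blocks.\<close>
  have sum_block: "(\<Sum>i<n. h i) = (\<Sum>a<k c. h (e c a))"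
    if "\<And>i. i < n \<Longrightarrow> f i \<noteq> c \<Longrightarrow> h i = 0" for h :: "nat \<Rightarrow> 'a" and c
  proof -
    have "(\<Sum>i<n. h i) = (\<Sum>i\<in>I c. h i)"
      by (rule sum.mono_neutral_right) (auto simp: I_def that)
    also have "\<dots> = (\<Sum>a<k c. h (e c a))"
      by (rule sum.reindex_bij_betw[OF e, symmetric])
    finally show ?thesis .
  qed
  define blocks :: "'a mat \<Rightarrow> 'a \<Rightarrow> 'a mat"
    where "blocks U c = Matrix.mat (k c) (k c) (\<lambda>(a, b). U $$ (e c a, e c b))" for U c
  define join :: "('a \<Rightarrow> 'a mat) \<Rightarrow> 'a mat"
    where "join W = Matrix.mat n n (\<lambda>(i, j). if f i = f j then W (f i) $$ (g i, g j) else 0)" for W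
  \<comment> \<open>The product runs over all field elements; a value that \<open>f\<close> does not
    take below \<open>n\<close> has an empty fibre and contributes the one-element group of size
    0.\<close>
  have "bij_betw blocks (diag_stabilizer n f) (PiE UNIV (\<lambda>c. orthogonal_group (k c)))"
  proof (rule bij_betw_byWitness[where f' = join])
    show "\<forall>U\<in>diag_stabilizer n f. join (blocks U) = U"
    proof
      fix U assume "U \<in> diag_stabilizer n f"
      then have U: "U \<in> carrier_mat n n" "\<And>i j. i < n \<Longrightarrow> j < n \<Longrightarrow> f i \<noteq> f j \<Longrightarrow> U $$ (i, j) = 0"
        by (simp_all add: diag_stabilizer_iff)
      show "join (blocks U) = U"
      proof (rule eq_matI)
        fix i j assume "i < dim_row U" "j < dim_col U"
        then have ij: "i < n" "j < n" using U(1) by simp_all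
        show "join (blocks U) $$ (i, j) = U $$ (i, j)"
          using ij U(2)[OF ij] g_lt[OF ij(1)] g_lt[OF ij(2)] eg[OF ij(1)] eg[OF ij(2)]
          by (cases "f i = f j") (simp_all add: join_def blocks_def)
      qed (use U(1) in \<open>simp_all add: join_def\<close>)
    qed
    show "\<forall>W\<in>PiE UNIV (\<lambda>c. orthogonal_group (k c)). blocks (join W) = W"
    proof (intro ballI ext)
      fix W c assume "W \<in> PiE UNIV (\<lambda>c. orthogonal_group (k c) :: 'a mat set)"
      then have "W c \<in> orthogonal_group (k c)" by blast
      then have Wc: "W c \<in> carrier_mat (k c) (k c)" by (rule orthogonal_group_carrier)
      show "blocks (join W) c = W c"
      proof (rule eq_matI)
        fix a b assume "a < dim_row (W c)" "b < dim_col (W c)"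
        then have ab: "a < k c" "b < k c" using Wc by simp_all
        then show "blocks (join W) c $$ (a, b) = W c $$ (a, b)"
          by (simp add: blocks_def join_def e_in ge)
      qed (use Wc in \<open>simp_all add: blocks_def\<close>)
    qed
    show "blocks ` diag_stabilizer n f \<subseteq> PiE UNIV (\<lambda>c. orthogonal_group (k c))"
    proof (intro image_subsetI PiE_I)
      fix U c assume "U \<in> diag_stabilizer n f"
      then have U: "U \<in> orthogonal_group n" "\<And>i j. i < n \<Longrightarrow> j < n \<Longrightarrow> f i \<noteq> f j \<Longrightarrow> U $$ (i, j) = 0"
        by (simp_all add: diag_stabilizer_iff)
      show "blocks U c \<in> orthogonal_group (k c)"
        unfolding orthogonal_group_iff_sum
      proof (intro conjI allI impI)
        fix a b assume ab: "a < k c" "b < k c"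
        then have "(\<Sum>x<k c. blocks U c $$ (x, a) * blocks U c $$ (x, b)) =
            (\<Sum>x<k c. U $$ (e c x, e c a) * U $$ (e c x, e c b))"
          by (simp add: blocks_def)
        also have "\<dots> = (\<Sum>i<n. U $$ (i, e c a) * U $$ (i, e c b))"
          using U(2) e_in ab by (intro sum_block[symmetric]) simp
        also have "\<dots> = (if e c a = e c b then 1 else 0)"
          using U(1) e_in ab unfolding orthogonal_group_iff_sum by blast
        finally show "(\<Sum>x<k c. blocks U c $$ (x, a) * blocks U c $$ (x, b)) = (if a = b then 1 else 0)"
          using ab by (simp add: e_inj)
      qed (simp add: blocks_def)
    qed simp
    show "join ` PiE UNIV (\<lambda>c. orthogonal_group (k c)) \<subseteq> diag_stabilizer n f"
    proof (rule image_subsetI)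
      fix W assume "W \<in> PiE UNIV (\<lambda>c. orthogonal_group (k c) :: 'a mat set)"
      then have W: "\<And>c. W c \<in> orthogonal_group (k c)" by blast
      have "(\<Sum>i<n. join W $$ (i, j) * join W $$ (i, l)) = (if j = l then 1 else 0)"
        if jl: "j < n" "l < n" for j l
      \<comment> \<open>Columns from the same fibre are compared inside one block; columns from
        different fibres have disjoint supports.\<close>
      proof (cases "f j = f l")
        case True
        have "(\<Sum>i<n. join W $$ (i, j) * join W $$ (i, l)) =
            (\<Sum>x<k (f j). join W $$ (e (f j) x, j) * join W $$ (e (f j) x, l))"
          using jl by (intro sum_block) (simp add: join_def)
        also have "\<dots> = (\<Sum>x<k (f j). W (f j) $$ (x, g j) * W (f j) $$ (x, g l))"
          using jl True by (intro sum.cong) (simp_all add: join_def e_in ge)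
        also have "\<dots> = (if g j = g l then 1 else 0)"
          using W[of "f j"] g_lt[OF jl(1)] g_lt[OF jl(2)] True
          unfolding orthogonal_group_iff_sum by simp
        also have "g j = g l \<longleftrightarrow> j = l" using eg[OF jl(1)] eg[OF jl(2)] True by metis
        finally show ?thesis .
      next
        case False
        then have "join W $$ (i, j) * join W $$ (i, l) = 0" if "i < n" for i
          using that jl by (auto simp: join_def)
        then have "(\<Sum>i<n. join W $$ (i, j) * join W $$ (i, l)) = 0"
          by (intro sum.neutral) simp
        with False show ?thesis by auto
      qed
      then show "join W \<in> diag_stabilizer n f"
        by (auto simp: diag_stabilizer_iff orthogonal_group_iff_sum join_def)
    qed
  qed
  then have "card (diag_stabilizer n f) = card (PiE UNIV (\<lambda>c. orthogonal_group (k c) :: 'a mat set))"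
    by (rule bij_betw_same_card)
  also have "\<dots> = (\<Prod>c\<in>UNIV. card (orthogonal_group (k c) :: 'a mat set))"
    by (rule card_PiE) simp
  finally show ?thesis by (simp add: k_def I_def)
qed

subsection \<open>Counting by spectrum\<close>

text \<open>Labelling by a multiset instead of by \<open>f\<close> removes the choice of an order of
  the eigenvalues, so that different labels give disjoint sets.\<close>

definition spectrum_class :: "nat \<Rightarrow> 'a::field multiset \<Rightarrow> 'a mat set" where
  "spectrum_class n M = {A. \<exists>f. image_mset f (mset_set {..<n}) = M \<and> A \<in> diag_orbit n f}"

lemma obtain_enumeration:
  assumes "size M = n"
  obtains f where "image_mset f (mset_set {..<n}) = M"
proof -
  obtain xs where xs: "mset xs = M" using ex_mset by blast
  have "image_mset (nth xs) (mset_set {..<length xs}) = mset (map (nth xs) [0..<length xs])"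
    by (simp only: mset_map mset_upt lessThan_atLeast0)
  moreover have "length xs = n" using xs assms by auto
  ultimately have "image_mset (nth xs) (mset_set {..<n}) = M"
    unfolding map_nth using xs by simp
  then show ?thesis by (rule that)
qed

text \<open>All enumerations of one multiset give the same orbit, so the union over enumerations
  collapses.\<close>

lemma spectrum_class_eq_diag_orbit:
  "spectrum_class n (image_mset f (mset_set {..<n})) = diag_orbit n f"
proof (intro equalityI subsetI)
  fix A assume "A \<in> spectrum_class n (image_mset f (mset_set {..<n}))"
  then obtain g where g: "image_mset g (mset_set {..<n}) = image_mset f (mset_set {..<n})"
    and A: "A \<in> diag_orbit n g"
    unfolding spectrum_class_def by blast
  show "A \<in> diag_orbit n f" using A unfolding diag_orbit_cong[OF g] .
qed (unfold spectrum_class_def, blast)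

lemma count_image_mset_lessThan:
  "count (image_mset f (mset_set {..<n::nat})) c = card {i. i < n \<and> f i = c}"
  by (simp add: count_image_mset_eq_card_vimage)

text \<open>Orbit-stabilizer for any enumeration of \<open>M\<close>: the block sizes of the
  stabilizer are the multiplicities in \<open>M\<close>.\<close>

lemma card_spectrum_class:
  fixes M :: "'a::{field,finite} multiset"
  assumes "size M = n"
  shows "card (spectrum_class n M) * (\<Prod>c\<in>UNIV. card (orthogonal_group (count M c) :: 'a mat set)) =
    card (orthogonal_group n :: 'a mat set)"
proof -
  obtain f where f: "image_mset f (mset_set {..<n}) = M" using obtain_enumeration[OF assms] .
  then have count: "count M c = card {i. i < n \<and> f i = c}" for c
    using count_image_mset_lessThan[of f n c] by simp
  show ?thesis
    using card_diag_orbit_mult_card_diag_stabilizer[of n f]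
    unfolding card_diag_stabilizer count f[symmetric] spectrum_class_eq_diag_orbit
    by (simp add: count_image_mset_lessThan)
qed

text \<open>The label is recovered from any member as the roots of its characteristic
  polynomial.\<close>

lemma spectrum_class_disjoint:
  assumes "M \<noteq> N"
  shows "spectrum_class n M \<inter> spectrum_class n N = {}"
proof (rule equals0I)
  fix A assume "A \<in> spectrum_class n M \<inter> spectrum_class n N"
  then have "proots (char_poly A) = M" "proots (char_poly A) = N"
    by (auto simp: spectrum_class_def dest: proots_char_poly_diag_orbit)
  with assms show False by simp
qed

lemma finite_spectrum_class: "finite (spectrum_class n (M :: 'a::{field,finite} multiset))"
  by (rule finite_subset[OF _ finite_carrier_mat[of n n]])
    (auto simp: spectrum_class_def dest: diag_orbit_carrier)

lemma psd4_set_eq_Union_spectrum_class: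
  assumes "r \<le> n"
  shows "psd4_set n r = (\<Union>M\<in>{M. size M = n \<and> count M 0 = n - r \<and> (\<forall>c\<in>#M. nonnegative c)}.
    spectrum_class n M)"
proof -
  \<comment> \<open>The number of nonzero diagonal entries and the multiplicity of 0 add up to
    \<open>n\<close>; \<open>r \<le> n\<close> ensures that the truncated difference
    \<open>n - r\<close> determines \<open>r\<close>.\<close>
  have rank: "vec_space.rank n A = r \<longleftrightarrow> count (image_mset f (mset_set {..<n})) 0 = n - r"
    if "A \<in> diag_orbit n f" for A and f :: "nat \<Rightarrow> 'a"
  proof -
    have "card {i. i < n \<and> f i \<noteq> 0} + card {i. i < n \<and> f i = 0} =
        card ({i. i < n \<and> f i \<noteq> 0} \<union> {i. i < n \<and> f i = 0})"
      by (rule card_Un_disjoint[symmetric]) auto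
    also have "{i. i < n \<and> f i \<noteq> 0} \<union> {i. i < n \<and> f i = 0} = {..<n}" by auto
    finally show ?thesis
      using rank_diag_orbit[OF that] assms by (auto simp: count_image_mset_lessThan)
  qed
  let ?Ms = "{M :: 'a multiset. size M = n \<and> count M 0 = n - r \<and> (\<forall>c\<in>#M. nonnegative c)}"
  have Ms: "image_mset f (mset_set {..<n}) \<in> ?Ms \<longleftrightarrow>
      count (image_mset f (mset_set {..<n})) 0 = n - r \<and> (\<forall>i<n. nonnegative (f i))" for f
    by auto
  show ?thesis
  proof (intro equalityI subsetI)
    fix A :: "'a mat" assume "A \<in> psd4_set n r"
    then obtain f where "\<forall>i<n. nonnegative (f i)" "A \<in> diag_orbit n f" "vec_space.rank n A = r"
      by (auto simp: psd4_set_def psd_type4_iff)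
    then show "A \<in> (\<Union>M\<in>?Ms. spectrum_class n M)"
      by (intro UN_I[of "image_mset f (mset_set {..<n})"])
        (simp_all only: Ms rank spectrum_class_eq_diag_orbit simp_thms)
  next
    fix A :: "'a mat" assume "A \<in> (\<Union>M\<in>?Ms. spectrum_class n M)"
    then obtain M where M: "M \<in> ?Ms" and "A \<in> spectrum_class n M" by (rule UN_E)
    then obtain f where f: "image_mset f (mset_set {..<n}) = M" and A: "A \<in> diag_orbit n f"
      by (auto simp: spectrum_class_def)
    from M have "\<forall>i<n. nonnegative (f i)" "vec_space.rank n A = r"
      unfolding f[symmetric] Ms rank[OF A] by blast+
    with A show "A \<in> psd4_set n r" unfolding psd4_set_def psd_type4_iff by blast
  qed
qed

section \<open>Summation over the multiplicities of the positive eigenvalues\<close>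

theorem theorem4p17:
  fixes n r s :: nat
  assumes "n \<ge> 1" and "r \<le> n"
    and "s = card {a :: 'a :: {field, finite}. positive a}"
  shows "(of_nat (card (psd4_set n r :: 'a mat set)) :: rat) =
    (\<Sum>ks \<in> {ks :: nat list. length ks = s \<and> sum_list ks = r}.
       of_nat (card (orthogonal_group n :: 'a mat set)) /
       ((\<Prod>i<s. of_nat (card (orthogonal_group (ks ! i) :: 'a mat set))) *
        of_nat (card (orthogonal_group (n - r) :: 'a mat set))))"
proof -
  let ?o = "\<lambda>k. card (orthogonal_group k :: 'a mat set)"
  let ?K = "{ks :: nat list. length ks = s \<and> sum_list ks = r}"
  define Ms where
    "Ms = {M :: 'a multiset. size M = n \<and> count M 0 = n - r \<and> (\<forall>c\<in>#M. nonnegative c)}"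
  \<comment> \<open>Fixing an enumeration of the positive elements lets \<open>ks ! i\<close> stand
    for the multiplicity of the eigenvalue \<open>a i\<close>.\<close>
  obtain a where a: "bij_betw a {..<s} {c :: 'a. positive c}"
    using ex_bij_betw_nat_finite[of "{c :: 'a. positive c}"] assms(3) by (auto simp: lessThan_atLeast0)
  have a_inj: "a i = a j \<longleftrightarrow> i = j" if "i < s" "j < s" for i j
    using bij_betw_imp_inj_on[OF a] that by (auto dest: inj_onD)
  have a_pos: "positive (a i)" if "i < s" for i using bij_betwE[OF a] that by simp
  then have a_nz: "a i \<noteq> 0" if "i < s" for i using that by (auto simp: positive_def)
  have pos_ex: "\<exists>i<s. c = a i" if "positive c" for c
    using bij_betw_imp_surj_on[OF a] that by (auto simp: set_eq_iff)
  have nonneg_set: "{c :: 'a. nonnegative c} = insert 0 (a ` {..<s})"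
    using bij_betw_imp_surj_on[OF a] by (auto simp: nonnegative_def)
  have nonneg_sum: "(\<Sum>c | nonnegative c. h c) = (\<Sum>i<s. h (a i)) + h 0" for h :: "'a \<Rightarrow> nat"
    unfolding nonneg_set using a_nz bij_betw_imp_inj_on[OF a]
    by (subst sum.insert) (auto simp: sum.reindex)
  have nonneg_prod: "(\<Prod>c | nonnegative c. h c) = (\<Prod>i<s. h (a i)) * h 0" for h :: "'a \<Rightarrow> nat"
    unfolding nonneg_set using a_nz bij_betw_imp_inj_on[OF a]
    by (subst prod.insert) (auto simp: prod.reindex)
  have size_eq: "size M = (\<Sum>i<s. count M (a i)) + count M 0" if "\<forall>c\<in>#M. nonnegative c" for M
  proof -
    have "size M = (\<Sum>c | nonnegative c. count M c)"
      unfolding size_multiset_overloaded_eq using that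
      by (intro sum.mono_neutral_left) (auto simp: not_in_iff)
    then show ?thesis by (simp add: nonneg_sum)
  qed

  define toM where
    "toM ks = (\<Sum>i<s. replicate_mset (ks ! i) (a i)) + replicate_mset (n - r) 0" for ks
  have count_a: "count (toM ks) (a i) = ks ! i" if "i < s" for ks i
  proof -
    have "count (toM ks) (a i) = (\<Sum>x<s. if a i = a x then ks ! x else 0)"
      using a_nz[OF that] by (simp add: toM_def count_sum)
    also have "\<dots> = (\<Sum>x<s. if i = x then ks ! x else 0)"
      using that by (intro sum.cong) (simp_all add: a_inj)
    finally show ?thesis using that by simp
  qed
  have count_0: "count (toM ks) 0 = n - r" for ks
    using a_nz by (simp add: toM_def count_sum)
  have nonneg_toM: "\<forall>c\<in>#toM ks. nonnegative c" for ks
    using a_pos by (auto simp: toM_def set_mset_sum nonnegative_def in_replicate_mset)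
  \<comment> \<open>The inverse reads off the multiplicities of the positive elements. A multiset in
    \<open>Ms\<close> is determined by these, as its multiplicity at 0 is prescribed and all others
    vanish.\<close>
  have bij: "bij_betw toM ?K Ms"
  proof (rule bij_betw_byWitness[where f' = "\<lambda>M. map (\<lambda>i. count M (a i)) [0..<s]"])
    show "\<forall>ks\<in>?K. map (\<lambda>i. count (toM ks) (a i)) [0..<s] = ks"
      by (auto intro!: nth_equalityI simp: count_a)
    show "\<forall>M\<in>Ms. toM (map (\<lambda>i. count M (a i)) [0..<s]) = M"
    proof
      fix M assume M: "M \<in> Ms"
      let ?N = "toM (map (\<lambda>i. count M (a i)) [0..<s])"
      show "?N = M"
      proof (rule multiset_eqI)
        fix c show "count ?N c = count M c"
        proof (cases "nonnegative c")
          case True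
          then show ?thesis
            using M pos_ex[of c] by (auto simp: nonnegative_def count_a count_0 Ms_def)
        next
          case False
          then show ?thesis using nonneg_toM M by (metis (no_types, lifting) Ms_def mem_Collect_eq not_in_iff)
        qed
      qed
    qed
    show "toM ` ?K \<subseteq> Ms"
    proof (rule image_subsetI)
      fix ks assume "ks \<in> ?K"
      then have ks: "length ks = s" "sum_list ks = r" by simp_all
      have "size (toM ks) = (\<Sum>i<s. ks ! i) + (n - r)"
        unfolding size_eq[OF nonneg_toM] by (simp add: count_a count_0)
      also have "(\<Sum>i<s. ks ! i) = r"
        using ks by (simp add: sum_list_sum_nth lessThan_atLeast0)
      finally show "toM ks \<in> Ms" using assms(2) count_0 nonneg_toM by (simp add: Ms_def)
    qed
    show "(\<lambda>M. map (\<lambda>i. count M (a i)) [0..<s]) ` Ms \<subseteq> ?K"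
    proof (rule image_subsetI)
      fix M assume "M \<in> Ms"
      then have M: "size M = n" "count M 0 = n - r" "\<forall>c\<in>#M. nonnegative c" by (simp_all add: Ms_def)
      then have "(\<Sum>i<s. count M (a i)) = r" using size_eq[OF M(3)] assms(2) by simp
      then show "map (\<lambda>i. count M (a i)) [0..<s] \<in> ?K"
        by (simp add: sum_list_sum_nth lessThan_atLeast0)
    qed
  qed
  have "finite ?K"
  proof (rule finite_subset)
    \<comment> \<open>No entry of a list of naturals exceeds its sum.\<close>
    show "?K \<subseteq> {ks. set ks \<subseteq> {..r} \<and> length ks = s}" using member_le_sum_list by fastforce
  qed (simp add: finite_lists_length_eq)
  then have "finite Ms" using bij_betw_finite[OF bij] by simp

  have o_pos: "?o k > 0" for k
    unfolding card_gt_0_iff using one_in_orthogonal_group finite_orthogonal_group by blast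
  have card_class: "(of_nat (card (spectrum_class n (toM ks))) :: rat) =
      of_nat (?o n) / ((\<Prod>i<s. of_nat (?o (ks ! i))) * of_nat (?o (n - r)))" if "ks \<in> ?K" for ks
  proof -
    \<comment> \<open>Elements that are not nonnegative have multiplicity 0, and their factor is the
      order 1 of the orthogonal group of size 0.\<close>
    have "(\<Prod>c\<in>UNIV. ?o (count (toM ks) c)) = (\<Prod>c | nonnegative c. ?o (count (toM ks) c))"
      using nonneg_toM[of ks]
      by (intro prod.mono_neutral_right) (auto simp: card_orthogonal_group_0 not_in_iff)
    also have "\<dots> = (\<Prod>i<s. ?o (ks ! i)) * ?o (n - r)"
      by (simp add: nonneg_prod count_a count_0)
    finally have "card (spectrum_class n (toM ks)) * ((\<Prod>i<s. ?o (ks ! i)) * ?o (n - r)) = ?o n"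
      using card_spectrum_class[of "toM ks" n] bij_betwE[OF bij] that by (simp add: Ms_def)
    then have "(of_nat (?o n) :: rat) = of_nat (card (spectrum_class n (toM ks))) *
        ((\<Prod>i<s. of_nat (?o (ks ! i))) * of_nat (?o (n - r)))"
      by (simp flip: of_nat_mult of_nat_prod)
    moreover have "(\<Prod>i<s. (of_nat (?o (ks ! i)) :: rat)) * of_nat (?o (n - r)) \<noteq> 0"
      using o_pos by simp
    ultimately show ?thesis by (simp add: eq_divide_eq)
  qed
  \<comment> \<open>The classes are finite and disjoint, so their sizes add up; \<open>bij\<close>
    then turns the sum over spectra into a sum over tuples.\<close>
  have "card (psd4_set n r :: 'a mat set) = (\<Sum>M\<in>Ms. card (spectrum_class n M))"
    unfolding psd4_set_eq_Union_spectrum_class[OF assms(2)] Ms_def[symmetric]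
    using \<open>finite Ms\<close> by (intro card_UN_disjoint) (simp_all add: finite_spectrum_class spectrum_class_disjoint)
  also have "\<dots> = (\<Sum>ks\<in>?K. card (spectrum_class n (toM ks)))"
    by (rule sum.reindex_bij_betw[OF bij, symmetric])
  finally show ?thesis
    by (simp only: of_nat_sum) (intro sum.cong refl card_class)
qed

end
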